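(* Let $I=[u,u']$ and $J=[v,v']$ be two compact intervals and let $x\in C^1(I,V)$ and $y\in C^1(J,V)$. The signature kernel $k_{x,y}:I\times J\to\mathbb{R}$, $k_{x,y}(s,t)=\langle S(x)_s,S(y)_t\rangle$, is a solution of the linear, second order, hyperbolic PDE $$\frac{\partial^2 k_{x,y}}{\partial s\,\partial t}(s,t)=\langle \dot x_s,\dot y_t\rangle_V\,k_{x,y}(s,t),\qquad k_{x,y}(u,\cdot)=1,\quad k_{x,y}(\cdot,v)=1,$$ where $\dot x_s=\frac{dx_p}{dp}\big|_{p=s}$ and $\dot y_t=\frac{dy_q}{dq}\big|_{q=t}$ are the derivatives of $x$ and $y$ at times $s$ and $t$ respectively.
   Context: $V$ is a $d$-dimensional real Banach space with canonical basis $e_1,\dots,e_d$ and an inner product $\langle\cdot,\cdot\rangle_V$. $C^1(I,V)$ is the space of continuously differentiable paths $I\to V$. For $k\ge 1$, $V^{\otimes k}$ carries the inner product determined by $\langle e_{i_1}\otimes\dots\otimes e_{i_k},e_{j_1}\otimes\dots\otimes e_{j_k}\rangle_{V^{\otimes k}}=\prod_{l=1}^k\langle e_{i_l},e_{j_l}\rangle_V$, and $V^{\otimes 0}=\mathbb{R}$. Let $T((V))=\prod_{k\ge0}V^{\otimes k}$; for $A=(a_0,a_1,\dots)$, $B=(b_0,b_1,\dots)$ set $\langle A,B\rangle=\sum_{k\ge0}\langle a_k,b_k\rangle_{V^{\otimes k}}$ (whenever the series converges, as it does for signatures). The signature of a path $x$ over $[s,t]$ is $$S(x)_{[s,t]}=\Big(1,\int_{s<u_1<t}dx_{u_1},\dots,\int\cdots\int_{s<u_1<\dots<u_k<t}dx_{u_1}\otimes\cdots\otimes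 dx_{u_k},\dots\Big)\in T((V)).$$ For a path $x$ defined on $[u,u']$ write $S(x)_s:=S(x)_{[u,s]}$, and for $y$ defined on $[v,v']$ write $S(y)_t:=S(y)_{[v,t]}$. *)

theory Defs
  imports "HOL-Analysis.Analysis"
begin

definition is_basis :: "('d::finite \<Rightarrow> 'a::real_vector) \<Rightarrow> bool" where
  "is_basis e \<longleftrightarrow> inj e \<and> independent (range e) \<and> span (range e) = UNIV"

definition coord :: "('d::finite \<Rightarrow> 'a::real_vector) \<Rightarrow> 'd \<Rightarrow> 'a \<Rightarrow> real" where
  "coord e i v = representation (range e) v (e i)"

text \<open>The norm of the Banach space \<open>V\<close> need not be the one induced by the inner product, and
  the basis need not be orthonormal.\<close>

definition is_inner_product :: "('a::real_vector \<Rightarrow> 'a \<Rightarrow> real) \<Rightarrow> bool" where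
  "is_inner_product ip \<longleftrightarrow>
     bilinear ip \<and> (\<forall>a b. ip a b = ip b a) \<and> (\<forall>a. a \<noteq> 0 \<longrightarrow> ip a a > 0)"

text \<open>One-sided derivatives are taken at the two end points; the library notion
  \<open>C1_differentiable_on\<close> would ask for two-sided derivatives there.\<close>

definition C1_path :: "real set \<Rightarrow> (real \<Rightarrow> 'a::real_normed_vector) \<Rightarrow> bool" where
  "C1_path I x \<longleftrightarrow>
     x differentiable_on I \<and> continuous_on I (\<lambda>s. vector_derivative x (at s within I))"

text \<open>An element \<open>A\<close> of \<open>T((V))\<close> is given by its coefficients with respect to the basis tensors:
  the component of \<open>A\<close> in the \<open>k\<close>-th tensor power of \<open>V\<close> is the sum, over all words
  \<open>w = [i\<^sub>1, \<dots>, i\<^sub>k]\<close>, of \<open>A w\<close> times \<open>e i\<^sub>1 \<otimes> \<dots> \<otimes> e i\<^sub>k\<close>.\<close>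

type_synonym 'd tensor_series = "'d list \<Rightarrow> real"

text \<open>The bilinear extension of
  \<open>\<langle>e i\<^sub>1 \<otimes> \<dots> \<otimes> e i\<^sub>k, e j\<^sub>1 \<otimes> \<dots> \<otimes> e j\<^sub>k\<rangle> = (\<Prod>l. \<langle>e i\<^sub>l, e j\<^sub>l\<rangle>)\<close>, applied to the components of
  degree \<open>k\<close>.\<close>

definition tensor_inner ::
    "('d::finite \<Rightarrow> 'a) \<Rightarrow> ('a \<Rightarrow> 'a \<Rightarrow> real) \<Rightarrow> nat \<Rightarrow> 'd tensor_series \<Rightarrow> 'd tensor_series \<Rightarrow> real"
  where
  "tensor_inner e ip k A B =
     (\<Sum>w | length w = k. \<Sum>w' | length w' = k.
        A w * B w' * (\<Prod>l<k. ip (e (w ! l)) (e (w' ! l))))"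

definition series_inner ::
    "('d::finite \<Rightarrow> 'a) \<Rightarrow> ('a \<Rightarrow> 'a \<Rightarrow> real) \<Rightarrow> 'd tensor_series \<Rightarrow> 'd tensor_series \<Rightarrow> real" where
  "series_inner e ip A B = (\<Sum>k. tensor_inner e ip k A B)"

definition open_simplex :: "nat \<Rightarrow> real \<Rightarrow> real \<Rightarrow> (nat \<Rightarrow> real) set" where
  "open_simplex k s t = {p. strict_mono_on {..<k} p \<and> p ` {..<k} \<subseteq> {s<..<t}}"

text \<open>The coefficient at the word \<open>[i\<^sub>1, \<dots>, i\<^sub>k]\<close> is the \<open>k\<close>-fold integral of the coordinates of \<open>dx\<close> over the simplex
  \<open>s < p 0 < \<dots> < p (k - 1) < t\<close>, where for a continuously differentiable path \<open>dx\<close> is the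
  derivative of \<open>x\<close> times Lebesgue measure. All \<open>p l\<close> are interior points of \<open>[s, t]\<close>, so the
  two-sided derivative is the right one. For the empty word, \<open>Pi\<^sub>M {}\<close> is a unit point mass and
  the value is 1, as required of the component of degree 0.\<close>

definition signature ::
    "('d::finite \<Rightarrow> 'a::real_normed_vector) \<Rightarrow> (real \<Rightarrow> 'a) \<Rightarrow> real \<Rightarrow> real \<Rightarrow> 'd tensor_series" where
  "signature e x s t w =
     (LINT p : open_simplex (length w) s t | Pi\<^sub>M {..<length w} (\<lambda>_. lborel).
        (\<Prod>l<length w. coord e (w ! l) (vector_derivative x (at (p l)))))"

definition signature_kernel ::
    "('d::finite \<Rightarrow> 'a::real_normed_vector) \<Rightarrow> ('a \<Rightarrow> 'a \<Rightarrow> real) \<Rightarrow>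
     (real \<Rightarrow> 'a) \<Rightarrow> (real \<Rightarrow> 'a) \<Rightarrow> real \<Rightarrow> real \<Rightarrow> real \<Rightarrow> real \<Rightarrow> real" where
  "signature_kernel e ip x y u v s t =
     series_inner e ip (signature e x u s) (signature e y v t)"

text \<open>On all of \<open>S \<times> T\<close>, \<open>f\<close> has a partial derivative in its second argument, and this has the
  partial derivative \<open>D\<close> in its first argument (one-sided at end points of intervals).\<close>

definition has_mixed_derivative_on ::
    "(real \<Rightarrow> real \<Rightarrow> real) \<Rightarrow> (real \<Rightarrow> real \<Rightarrow> real) \<Rightarrow> real set \<Rightarrow> real set \<Rightarrow> bool" where
  "has_mixed_derivative_on f D S T \<longleftrightarrow>
     (\<exists>g. \<forall>s\<in>S. \<forall>t\<in>T.
        ((\<lambda>t'. f s t') has_real_derivative g s t) (at t within T) \<and>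
        ((\<lambda>s'. g s' t) has_real_derivative D s t) (at s within S))"

end

theory Submission
  imports Defs
begin

text \<open>In coordinates, the coefficient of the signature at a word is an iterated integral, and splitting
  off the outermost integration gives the differential equation \<open>dS(x)\<^sub>s = S(x)\<^sub>s \<otimes> dx\<^sub>s\<close>
  (\<open>simplex_integral_Suc\<close>, \<open>signature_has_derivative\<close>). The inner product is multiplicative,
  \<open>\<langle>A \<otimes> a, B \<otimes> b\<rangle> = \<langle>A, B\<rangle> \<langle>a, b\<rangle>\<close> (\<open>tensor_inner_append_vector_Suc\<close>), so
  differentiating \<open>\<langle>S(x)\<^sub>s, S(y)\<^sub>t\<rangle>\<close> once in each variable yields formally
  \<open>\<langle>S(x)\<^sub>s \<otimes> dx\<^sub>s, S(y)\<^sub>t \<otimes> dy\<^sub>t\<rangle> = \<langle>S(x)\<^sub>s, S(y)\<^sub>t\<rangle> \<langle>dx\<^sub>s, dy\<^sub>t\<rangle>\<close>.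

  The kernel is an infinite series over the degrees, and differentiating it term by term needs uniform
  convergence of the differentiated series. For this, the coefficients of the signature of degree \<open>n\<close>
  are \<open>O(R ^ n / fact n)\<close>, uniformly on the interval, and so are their derivatives
  (\<open>signature_exponential_bound\<close>), while there are only exponentially many pairs of words of a given
  length (\<open>tensor_inner_bound\<close>). The other order of differentiation follows by symmetry of the inner
  product, and the boundary values hold because the signature over a degenerate interval is the unit.\<close>

section \<open>Coordinates with respect to a basis\<close>

lemma coord_basis:
  assumes "is_basis e"
  shows "coord e i (e j) = (if i = j then 1 else 0)"
  using assms unfolding is_basis_def coord_def
  by (subst representation_basis) (auto dest: injD)

lemma linear_coord:
  assumes "is_basis e"
  shows "linear (coord e i)"
proof -
  from assms have e: "independent (range e)" "v \<in> span (range e)" for v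
    by (auto simp: is_basis_def)
  show ?thesis
    unfolding coord_def
    by (rule linearI) (simp_all add: representation_add[OF e(1) e(2) e(2)] representation_scale[OF e(1) e(2)])
qed

lemma sum_coord_scaleR:
  assumes "is_basis e"
  shows "(\<Sum>i\<in>UNIV. coord e i v *\<^sub>R e i) = v"
proof -
  have "(\<Sum>b\<in>range e. representation (range e) v b *\<^sub>R b) = v"
    using assms by (intro sum_representation_eq) (auto simp: is_basis_def)
  then show ?thesis
    using assms by (simp add: coord_def sum.reindex is_basis_def)
qed

text \<open>The norm on the space is arbitrary, so boundedness of a coordinate functional has to come from
  finite dimension. The linear map from Euclidean coordinate space has a nonzero, hence positive,
  minimum of the norm on the compact unit sphere; by homogeneity this bounds the norm of a vector
  from below by a multiple of the Euclidean norm of its coordinates.\<close>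

lemma bounded_linear_coord:
  fixes e :: "'d::finite \<Rightarrow> 'a::real_normed_vector"
  assumes "is_basis e"
  shows "bounded_linear (coord e i)"
proof -
  define T where "T \<equiv> (\<lambda>c :: real ^ 'd. \<Sum>i\<in>UNIV. (c $ i) *\<^sub>R e i)"
  have coord_T: "coord e i (T c) = c $ i" for c i
    using linear_coord[OF assms, of i]
    by (simp add: T_def linear_sum linear_scale coord_basis[OF assms] if_distrib cong: if_cong)
  have T_scale: "T (r *\<^sub>R c) = r *\<^sub>R T c" for r c
    by (simp add: T_def scaleR_sum_right)
  have "continuous_on (sphere 0 1) (\<lambda>c. norm (T c))"
    unfolding T_def by (intro continuous_intros)
  moreover have "(sphere 0 1 :: (real ^ 'd) set) \<noteq> {}"
    using norm_axis_1[of "undefined :: 'd"] by (metis empty_iff mem_sphere_0)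
  ultimately obtain c0 :: "real ^ 'd" where c0: "norm c0 = 1"
    and min: "\<And>c. norm c = 1 \<Longrightarrow> norm (T c0) \<le> norm (T c)"
    using continuous_attains_inf[of "sphere (0 :: real ^ 'd) 1" "\<lambda>c. norm (T c)"] by auto
  have "T c0 \<noteq> 0"
  proof
    assume "T c0 = 0"
    then have "c0 $ i = 0" for i
      using coord_T[of i c0] linear_0[OF linear_coord[OF assms]] by simp
    then have "c0 = 0" by (simp add: vec_eq_iff)
    then show False using c0 by simp
  qed
  then have m: "norm (T c0) > 0" by simp
  have bound: "norm (coord e i v) \<le> norm v * (1 / norm (T c0))" for v
  proof -
    define c where "c \<equiv> (\<chi> i. coord e i v)"
    have T_c: "T c = v"
      by (simp add: T_def c_def sum_coord_scaleR[OF assms])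
    have "norm c * norm (T c0) \<le> norm v"
    proof (cases "c = 0")
      case False
      then have "norm (T c0) \<le> norm (T ((1 / norm c) *\<^sub>R c))"
        by (intro min) simp
      also have "\<dots> = norm v / norm c"
        by (simp only: T_scale T_c) simp
      finally show ?thesis using False by (simp add: field_simps)
    qed simp
    moreover have "norm (coord e i v) * norm (T c0) \<le> norm c * norm (T c0)"
      using component_le_norm_cart[of c i] by (simp add: c_def mult_right_mono)
    ultimately have "norm (coord e i v) * norm (T c0) \<le> norm v" by linarith
    then show ?thesis using m by (simp add: pos_le_divide_eq del: zero_less_norm_iff)
  qed
  show ?thesis
    using linear_coord[OF assms, of i] bound
    by (intro bounded_linear_intro[where K = "1 / norm (T c0)"]) (auto simp: linear_add linear_scale)
qed

text \<open>The coordinates of the derivative of the path relative to \<open>I\<close>, hence one-sided at the end points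
  of an interval. In the interior, where the signature is integrated, it agrees with the two-sided
  derivative; unlike the latter it is continuous up to the end points.\<close>

definition velocity :: "('d::finite \<Rightarrow> 'a::real_normed_vector) \<Rightarrow> real set \<Rightarrow> (real \<Rightarrow> 'a) \<Rightarrow> real \<Rightarrow> 'd \<Rightarrow> real" where
  "velocity e I x s i = coord e i (vector_derivative x (at s within I))"

lemma continuous_on_velocity:
  assumes "is_basis e" "C1_path I x"
  shows "continuous_on I (\<lambda>s. velocity e I x s i)"
  using assms bounded_linear.continuous_on[OF bounded_linear_coord]
  by (auto simp: velocity_def C1_path_def)

lemma inner_velocity:
  assumes "is_basis e" "is_inner_product ip"
  shows "(\<Sum>i\<in>UNIV. \<Sum>j\<in>UNIV. velocity e I x s i * velocity e J y t j * ip (e i) (e j)) =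
    ip (vector_derivative x (at s within I)) (vector_derivative y (at t within J))"
proof -
  have ip: "bilinear ip" using assms(2) by (simp add: is_inner_product_def)
  have "ip v w = (\<Sum>i\<in>UNIV. \<Sum>j\<in>UNIV. coord e i v * coord e j w * ip (e i) (e j))" for v w
  proof -
    have "ip v w = ip (\<Sum>i\<in>UNIV. coord e i v *\<^sub>R e i) (\<Sum>j\<in>UNIV. coord e j w *\<^sub>R e j)"
      by (simp add: sum_coord_scaleR[OF assms(1)])
    also have "\<dots> = (\<Sum>i\<in>UNIV. \<Sum>j\<in>UNIV. coord e i v * coord e j w * ip (e i) (e j))"
      by (simp add: bilinear_sum[OF ip] sum.cartesian_product bilinear_lmul[OF ip] bilinear_rmul[OF ip] mult_ac)
    finally show ?thesis .
  qed
  then show ?thesis unfolding velocity_def by (rule sym)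
qed

section \<open>Integrals over simplices\<close>

lemma open_simplex_0 [simp]: "open_simplex 0 s t = UNIV"
  by (auto simp: open_simplex_def)

text \<open>The last point of an increasing tuple is peeled off, because the upper limit of the remaining ones
  is then that last point: this is the form in which the signature is an iterated integral.\<close>

lemma open_simplex_Suc:
  "p \<in> open_simplex (Suc k) s t \<longleftrightarrow> p k \<in> {s<..<t} \<and> p \<in> open_simplex k s (p k)"
proof -
  have "strict_mono_on {..<Suc k} p \<longleftrightarrow> strict_mono_on {..<k} p \<and> (\<forall>i<k. p i < p k)"
    by (auto simp: strict_mono_on_def less_Suc_eq)
  then show ?thesis
    by (force simp: open_simplex_def lessThan_Suc)
qed

lemma open_simplex_cong:
  "(\<And>l. l < k \<Longrightarrow> p l = q l) \<Longrightarrow> p \<in> open_simplex k s t \<longleftrightarrow> q \<in> open_simplex k s t"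
  by (auto simp: open_simplex_def strict_mono_on_def image_subset_iff)

lemma pred_open_simplex [measurable]:
  "Measurable.pred (Pi\<^sub>M {..<k} (\<lambda>_. lborel)) (\<lambda>p. p \<in> open_simplex k s t)"
proof -
  have "(\<lambda>p. p \<in> open_simplex k s t) =
      (\<lambda>p. (\<forall>j\<in>{..<k}. \<forall>i\<in>{..<k}. i < j \<longrightarrow> p i < p j) \<and> (\<forall>i\<in>{..<k}. s < p i \<and> p i < t))"
    by (auto simp: open_simplex_def strict_mono_on_def image_subset_iff fun_eq_iff)
  then show ?thesis by simp
qed

text \<open>Fubini for the simplex, integrating over the last point outermost. The factors are only known to be
  integrable on \<open>{s<..<t}\<close>, so they are cut off outside of it; on the simplex this changes nothing,
  and it makes the integrand a measurable function dominated by an integrable product.\<close>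

lemma simplex_integral_Suc:
  fixes f :: "nat \<Rightarrow> real \<Rightarrow> real"
  assumes f: "\<And>l. l \<le> k \<Longrightarrow> set_integrable lborel {s<..<t} (f l)"
  shows "(LINT p : open_simplex (Suc k) s t | Pi\<^sub>M {..<Suc k} (\<lambda>_. lborel). (\<Prod>l<Suc k. f l (p l))) =
    (LINT r : {s<..<t} | lborel. (LINT p : open_simplex k s r | Pi\<^sub>M {..<k} (\<lambda>_. lborel). (\<Prod>l<k. f l (p l))) * f k r)"
proof -
  interpret product_sigma_finite "\<lambda>_::nat. lborel :: real measure"
    by standard
  define h where "h \<equiv> (\<lambda>l r. indicator {s<..<t} r *\<^sub>R f l r)"
  have h: "integrable lborel (h l)" if "l \<le> k" for l
    using f[OF that] by (simp add: h_def set_integrable_def)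
  have [measurable]: "h l \<in> borel_measurable lborel" if "l \<le> k" for l
    using h[OF that] by (rule borel_measurable_integrable)
  define F where "F \<equiv> (\<lambda>p. (if p \<in> open_simplex (Suc k) s t then 1 else 0) * (\<Prod>l<Suc k. h l (p l)))"
  define G where "G \<equiv> (\<lambda>r p. (if p \<in> open_simplex k s r then 1 else 0) * (\<Prod>l<k. h l (p l)))"
  have F_eq: "F = (\<lambda>p. indicator (open_simplex (Suc k) s t) p *\<^sub>R (\<Prod>l<Suc k. f l (p l)))"
    unfolding F_def h_def
    by (intro ext) (auto simp: open_simplex_def indicator_def image_subset_iff intro!: prod.cong)
  have G_eq: "G r = (\<lambda>p. indicator (open_simplex k s r) p *\<^sub>R (\<Prod>l<k. f l (p l)))" if "r < t" for r
  proof
    fix p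
    have "(\<Prod>l<k. h l (p l)) = (\<Prod>l<k. f l (p l))" if p: "p \<in> open_simplex k s r"
    proof (rule prod.cong)
      fix l assume "l \<in> {..<k}"
      then have "p l \<in> {s<..<r}" using p by (auto simp: open_simplex_def)
      then show "h l (p l) = f l (p l)" using \<open>r < t\<close> by (simp add: h_def)
    qed simp
    then show "G r p = indicator (open_simplex k s r) p *\<^sub>R (\<Prod>l<k. f l (p l))"
      by (simp add: G_def indicator_def)
  qed
  have "integrable (Pi\<^sub>M {..<Suc k} (\<lambda>_. lborel)) (\<lambda>p. \<Prod>l<Suc k. h l (p l))"
    using h by (intro product_integrable_prod) auto
  then have F_int: "integrable (Pi\<^sub>M {..<Suc k} (\<lambda>_. lborel)) F"
    unfolding F_def
    by (rule Bochner_Integration.integrable_bound) (auto intro!: borel_measurable_times borel_measurable_prod)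
  have "Measurable.pred (lborel \<Otimes>\<^sub>M Pi\<^sub>M {..<k} (\<lambda>_. lborel)) (\<lambda>z. snd z \<in> open_simplex k s (fst z))"
  proof -
    have "(\<lambda>z. snd z \<in> open_simplex k s (fst z)) =
        (\<lambda>z. (\<forall>j\<in>{..<k}. \<forall>i\<in>{..<k}. i < j \<longrightarrow> snd z i < snd z j) \<and> (\<forall>i\<in>{..<k}. s < snd z i \<and> snd z i < fst z))"
      by (auto simp: open_simplex_def strict_mono_on_def image_subset_iff fun_eq_iff)
    then show ?thesis by simp
  qed
  then have "(\<lambda>(r, p). G r p) \<in> borel_measurable (lborel \<Otimes>\<^sub>M Pi\<^sub>M {..<k} (\<lambda>_. lborel))"
    unfolding G_def case_prod_beta
    by (auto intro!: borel_measurable_times borel_measurable_prod)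
  then have "(\<lambda>r. integral\<^sup>L (Pi\<^sub>M {..<k} (\<lambda>_. lborel)) (G r)) \<in> borel_measurable lborel"
    by (intro sigma_finite_measure.borel_measurable_lebesgue_integral sigma_finite) auto
  then have meas: "(\<lambda>r. integral\<^sup>L (Pi\<^sub>M {..<k} (\<lambda>_. lborel)) (G r) * h k r) \<in> borel_measurable lborel"
    by (intro borel_measurable_times) auto
  \<comment> \<open>With the last coordinate as first factor of the product measure, it is integrated outermost.\<close>
  have un: "{..<Suc k} = {k} \<union> {..<k}" by auto
  have F_merge: "F (merge {k} {..<k} (p, q)) = G (p k) q * h k (p k)" for p q
  proof -
    have mk: "merge {k} {..<k} (p, q) k = p k" and ml: "\<And>l. l < k \<Longrightarrow> merge {k} {..<k} (p, q) l = q l"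
      by (auto simp: merge_def)
    have "merge {k} {..<k} (p, q) \<in> open_simplex k s (p k) \<longleftrightarrow> q \<in> open_simplex k s (p k)"
      by (rule open_simplex_cong) (rule ml)
    then show ?thesis
      by (auto simp: F_def G_def h_def open_simplex_Suc mk ml indicator_def)
  qed
  have "integral\<^sup>L (Pi\<^sub>M {..<Suc k} (\<lambda>_. lborel)) F =
      (\<integral>p. (\<integral>q. F (merge {k} {..<k} (p, q)) \<partial>Pi\<^sub>M {..<k} (\<lambda>_. lborel)) \<partial>Pi\<^sub>M {k} (\<lambda>_. lborel))"
    unfolding un by (rule product_integral_fold) (use F_int un in auto)
  also have "\<dots> = (\<integral>p. integral\<^sup>L (Pi\<^sub>M {..<k} (\<lambda>_. lborel)) (G (p k)) * h k (p k) \<partial>Pi\<^sub>M {k} (\<lambda>_. lborel))"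
    unfolding F_merge by simp
  also have "\<dots> = (\<integral>r. integral\<^sup>L (Pi\<^sub>M {..<k} (\<lambda>_. lborel)) (G r) * h k r \<partial>lborel)"
    by (rule product_integral_singleton[OF meas])
  also have "\<dots> = (\<integral>r. indicator {s<..<t} r *\<^sub>R
      ((LINT p : open_simplex k s r | Pi\<^sub>M {..<k} (\<lambda>_. lborel). (\<Prod>l<k. f l (p l))) * f k r) \<partial>lborel)"
    by (rule Bochner_Integration.integral_cong) (auto simp: h_def G_eq set_lebesgue_integral_def indicator_def)
  finally show ?thesis
    unfolding set_lebesgue_integral_def F_eq .
qed

section \<open>The differential equation of the signature\<close>

lemma signature_Nil [simp]: "signature e x s t [] = 1"
  by (simp add: signature_def set_lebesgue_integral_def PiM_empty lebesgue_integral_count_space_finite)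

lemma signature_snoc_LINT:
  assumes vel: "\<And>i. continuous_on {u..u'} (\<lambda>r. velocity e {u..u'} x r i)"
    and s: "s \<in> {u..u'}"
  shows "signature e x u s (w @ [i]) =
    (LINT r : {u<..<s} | lborel. signature e x u r w * velocity e {u..u'} x r i)"
proof -
  define f where "f \<equiv> (\<lambda>l r. coord e ((w @ [i]) ! l) (vector_derivative x (at r)))"
  have f_eq: "f l r = velocity e {u..u'} x r ((w @ [i]) ! l)" if "r \<in> {u<..<s}" for l r
  proof -
    have "r \<in> interior {u..u'}" using that s by auto
    then show ?thesis by (simp only: f_def velocity_def at_within_interior)
  qed
  have f_int: "set_integrable lborel {u<..<s} (f l)" for l
  proof -
    have "continuous_on {u..s} (\<lambda>r. velocity e {u..u'} x r ((w @ [i]) ! l))"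
      by (rule continuous_on_subset[OF vel]) (use s in auto)
    then have "set_integrable lborel {u..s} (\<lambda>r. velocity e {u..u'} x r ((w @ [i]) ! l))"
      by (rule borel_integrable_atLeastAtMost')
    then have "set_integrable lborel {u<..<s} (\<lambda>r. velocity e {u..u'} x r ((w @ [i]) ! l))"
      by (rule set_integrable_subset) auto
    then show ?thesis
      by (subst set_integrable_cong[OF refl refl f_eq]) auto
  qed
  have f_w: "(\<Prod>l<length w. f l (p l)) = (\<Prod>l<length w. coord e (w ! l) (vector_derivative x (at (p l))))" for p
    by (auto simp: f_def nth_append intro!: prod.cong)
  have "signature e x u s (w @ [i]) =
      (LINT p : open_simplex (Suc (length w)) u s | Pi\<^sub>M {..<Suc (length w)} (\<lambda>_. lborel).
        (\<Prod>l<Suc (length w). f l (p l)))"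
    by (simp only: signature_def f_def length_append_singleton)
  also have "\<dots> = (LINT r : {u<..<s} | lborel. signature e x u r w * f (length w) r)"
    by (subst simplex_integral_Suc[OF f_int]) (simp only: signature_def f_w)
  also have "\<dots> = (LINT r : {u<..<s} | lborel. signature e x u r w * velocity e {u..u'} x r i)"
    by (rule set_lebesgue_integral_cong) (auto simp: f_eq)
  finally show ?thesis .
qed

text \<open>Coefficients of the signature arise from one another by integrating against one more component of
  the velocity. Continuity in the end point is needed to pass from the Lebesgue integral to the
  gauge integral, and in turn follows from the integral formula; so both go by induction on the word.\<close>

lemma
  assumes vel: "\<And>i. continuous_on {u..u'} (\<lambda>r. velocity e {u..u'} x r i)"
  shows continuous_on_signature: "continuous_on {u..u'} (\<lambda>s. signature e x u s w)"
    and signature_snoc: "s \<in> {u..u'} \<Longrightarrow> signature e x u s (w @ [i]) =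
          integral {u..s} (\<lambda>r. signature e x u r w * velocity e {u..u'} x r i)"
proof -
  have step: "signature e x u s (w @ [i]) =
      integral {u..s} (\<lambda>r. signature e x u r w * velocity e {u..u'} x r i)"
    if cont: "continuous_on {u..u'} (\<lambda>s. signature e x u s w)" and s: "s \<in> {u..u'}" for s w i
  proof -
    have "continuous_on {u..s} (\<lambda>r. signature e x u r w * velocity e {u..u'} x r i)"
      by (rule continuous_on_subset[OF continuous_on_mult[OF cont vel]]) (use s in auto)
    then have "set_integrable lborel {u..s} (\<lambda>r. signature e x u r w * velocity e {u..u'} x r i)"
      by (rule borel_integrable_atLeastAtMost')
    then have "set_integrable lborel {u<..<s} (\<lambda>r. signature e x u r w * velocity e {u..u'} x r i)"
      by (rule set_integrable_subset) auto
    then show ?thesis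
      by (simp add: signature_snoc_LINT[OF vel s] set_borel_integral_eq_integral integral_open_interval_real)
  qed
  have cont: "continuous_on {u..u'} (\<lambda>s. signature e x u s w)" for w
  proof (induction w rule: rev_induct)
    case (snoc i w)
    have "continuous_on {u..u'} (\<lambda>s. integral {u..s} (\<lambda>r. signature e x u r w * velocity e {u..u'} x r i))"
      by (intro indefinite_integral_continuous_1 integrable_continuous_real continuous_on_mult snoc.IH vel)
    then show ?case
      by (rule continuous_on_eq) (rule step[OF snoc.IH, symmetric])
  qed simp
  show "continuous_on {u..u'} (\<lambda>s. signature e x u s w)" by (rule cont)
  show "s \<in> {u..u'} \<Longrightarrow> signature e x u s (w @ [i]) =
          integral {u..s} (\<lambda>r. signature e x u r w * velocity e {u..u'} x r i)"
    by (rule step[OF cont])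
qed

text \<open>The tensor product \<open>A \<otimes> a\<close> of a series with a vector, in coordinates.\<close>

definition append_vector :: "'d tensor_series \<Rightarrow> ('d \<Rightarrow> real) \<Rightarrow> 'd tensor_series" where
  "append_vector A a w = (if w = [] then 0 else A (butlast w) * a (last w))"

lemma append_vector_Nil [simp]: "append_vector A a [] = 0"
  and append_vector_snoc [simp]: "append_vector A a (w @ [i]) = A w * a i"
  by (simp_all add: append_vector_def)

text \<open>The differential equation \<open>dS = S \<otimes> dx\<close> of the signature, from the fundamental theorem of calculus.\<close>

lemma signature_has_derivative:
  assumes vel: "\<And>i. continuous_on {u..u'} (\<lambda>r. velocity e {u..u'} x r i)"
    and s: "s \<in> {u..u'}"
  shows "((\<lambda>s. signature e x u s w) has_real_derivative
           append_vector (signature e x u s) (velocity e {u..u'} x s) w) (at s within {u..u'})"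
proof (cases w rule: rev_cases)
  case (snoc w i)
  have "((\<lambda>s. integral {u..s} (\<lambda>r. signature e x u r w * velocity e {u..u'} x r i))
      has_real_derivative signature e x u s w * velocity e {u..u'} x s i) (at s within {u..u'})"
    by (intro integral_has_real_derivative s continuous_on_mult continuous_on_signature vel)
  then show ?thesis
    unfolding snoc append_vector_snoc has_field_derivative_def
    by (rule has_derivative_transform[OF s, rotated]) (rule signature_snoc[OF vel])
qed simp

section \<open>Factorial decay of the signature\<close>

text \<open>The bound is the iterated integral of the constant \<open>M\<close>: one more integration turns
  \<open>(M * (r - u)) ^ n / fact n * M\<close> into the bound for \<open>n + 1\<close>.\<close>

lemma signature_bound:
  assumes vel: "\<And>i. continuous_on {u..u'} (\<lambda>r. velocity e {u..u'} x r i)"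
    and M: "\<And>i r. r \<in> {u..u'} \<Longrightarrow> \<bar>velocity e {u..u'} x r i\<bar> \<le> M"
    and s: "s \<in> {u..u'}"
  shows "\<bar>signature e x u s w\<bar> \<le> (M * (s - u)) ^ length w / fact (length w)"
  using s
proof (induction w arbitrary: s rule: rev_induct)
  case (snoc i w)
  let ?n = "length w"
  have "0 \<le> M" using M[OF snoc.prems, of i] by linarith
  have "((\<lambda>r. (M * (r - u)) ^ Suc ?n / fact (Suc ?n)) has_vector_derivative
      (M * (r - u)) ^ ?n / fact ?n * M) (at r within {u..s})" for r
    unfolding has_real_derivative_iff_has_vector_derivative[symmetric]
    by (rule derivative_eq_intros refl | simp add: field_simps del: of_nat_Suc)+
  then have *: "((\<lambda>r. (M * (r - u)) ^ ?n / fact ?n * M) has_integral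
      (M * (s - u)) ^ Suc ?n / fact (Suc ?n) - (M * (u - u)) ^ Suc ?n / fact (Suc ?n)) {u..s}"
    using snoc.prems by (intro fundamental_theorem_of_calculus) auto
  have "norm (integral {u..s} (\<lambda>r. signature e x u r w * velocity e {u..u'} x r i)) \<le>
      integral {u..s} (\<lambda>r. (M * (r - u)) ^ ?n / fact ?n * M)"
  proof (rule integral_norm_bound_integral)
    show "(\<lambda>r. signature e x u r w * velocity e {u..u'} x r i) integrable_on {u..s}"
      by (intro integrable_continuous_real continuous_on_subset[OF continuous_on_mult[OF continuous_on_signature[OF vel] vel]])
         (use snoc.prems in auto)
    show "(\<lambda>r. (M * (r - u)) ^ ?n / fact ?n * M) integrable_on {u..s}"
      using * by (rule has_integral_integrable)
    fix r assume "r \<in> {u..s}"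
    then have r: "r \<in> {u..u'}" using snoc.prems by auto
    show "norm (signature e x u r w * velocity e {u..u'} x r i) \<le> (M * (r - u)) ^ ?n / fact ?n * M"
      unfolding real_norm_def abs_mult
      using snoc.IH[OF r] M[OF r] by (intro mult_mono) auto
  qed
  then show ?case
    using integral_unique[OF *] by (simp add: signature_snoc[OF vel snoc.prems])
qed simp

text \<open>Differentiating costs a factor of the order of the word length compared to \<open>signature_bound\<close>. The
  factor \<open>2\<close> in the base absorbs it, since \<open>n \<le> 2 ^ n\<close>; so the derivative satisfies a bound of
  the same shape.\<close>

lemma append_signature_bound:
  assumes vel: "\<And>i. continuous_on {u..u'} (\<lambda>r. velocity e {u..u'} x r i)"
    and M: "\<And>i r. r \<in> {u..u'} \<Longrightarrow> \<bar>velocity e {u..u'} x r i\<bar> \<le> M"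
    and s: "s \<in> {u..u'}" and "u < u'"
  shows "\<bar>append_vector (signature e x u s) (velocity e {u..u'} x s) w\<bar> \<le>
    (2 * M * (u' - u)) ^ length w / fact (length w) / (u' - u)"
proof (cases w rule: rev_cases)
  case (snoc v i)
  let ?n = "length v"
  have M0: "0 \<le> M" using M[OF s, of i] by linarith
  have "\<bar>signature e x u s v\<bar> \<le> (M * (s - u)) ^ ?n / fact ?n"
    by (rule signature_bound[OF vel M s])
  also have "\<dots> \<le> (M * (u' - u)) ^ ?n / fact ?n"
    using M0 s by (intro divide_right_mono power_mono mult_left_mono) auto
  finally have "\<bar>signature e x u s v * velocity e {u..u'} x s i\<bar> \<le> (M * (u' - u)) ^ ?n / fact ?n * M"
    unfolding abs_mult using M[OF s] by (intro mult_mono) (use M0 \<open>u < u'\<close> in auto)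
  also have "\<dots> = (real (Suc ?n)) * ((M * (u' - u)) ^ Suc ?n / fact (Suc ?n) / (u' - u))"
    using \<open>u < u'\<close> by (simp add: field_simps del: of_nat_Suc)
  also have "\<dots> \<le> 2 ^ Suc ?n * ((M * (u' - u)) ^ Suc ?n / fact (Suc ?n) / (u' - u))"
    using M0 \<open>u < u'\<close> of_nat_less_two_power[of "Suc ?n", where ?'a = real]
    by (intro mult_right_mono) auto
  also have "\<dots> = (2 * M * (u' - u)) ^ Suc ?n / fact (Suc ?n) / (u' - u)"
    by (simp add: power_mult_distrib)
  finally show ?thesis by (simp add: snoc)
qed (use assms in simp)

text \<open>One majorant serves for the signature and for its derivative, so that a single summable sequence
  dominates the kernel series and the series of its differentiated terms.\<close>

lemma signature_exponential_bound:
  fixes e :: "'d::finite \<Rightarrow> 'a::real_normed_vector"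
  assumes vel: "\<And>i. continuous_on {u..u'} (\<lambda>r. velocity e {u..u'} x r i)" and "u < u'"
  obtains c R where
    "\<And>s w. s \<in> {u..u'} \<Longrightarrow> \<bar>signature e x u s w\<bar> \<le> c * (R ^ length w / fact (length w))"
    "\<And>s w. s \<in> {u..u'} \<Longrightarrow> \<bar>append_vector (signature e x u s) (velocity e {u..u'} x s) w\<bar>
       \<le> c * (R ^ length w / fact (length w))"
proof -
  have "bounded (\<Union>i\<in>UNIV. (\<lambda>r. velocity e {u..u'} x r i) ` {u..u'})"
    by (intro bounded_UN finite ballI compact_imp_bounded compact_continuous_image vel compact_Icc)
  then obtain M where "\<forall>z\<in>(\<Union>i. (\<lambda>r. velocity e {u..u'} x r i) ` {u..u'}). norm z \<le> M"
    unfolding bounded_iff by blast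
  then have M: "\<bar>velocity e {u..u'} x r i\<bar> \<le> M" if "r \<in> {u..u'}" for i r
    using that by auto
  have M0: "0 \<le> M" using M[of u undefined] \<open>u < u'\<close> by auto
  let ?c = "max 1 (1 / (u' - u))" and ?R = "2 * M * (u' - u)"
  have R: "0 \<le> ?R ^ n / fact n" for n
    using M0 \<open>u < u'\<close> by simp
  show thesis
  proof (rule that[of ?c ?R])
    fix s and w :: "'d list" assume s: "s \<in> {u..u'}"
    have "\<bar>signature e x u s w\<bar> \<le> (M * (s - u)) ^ length w / fact (length w)"
      by (rule signature_bound[OF vel M s])
    also have "\<dots> \<le> 1 * (?R ^ length w / fact (length w))"
      using mult_mono[of M "2 * M" "s - u" "u' - u"] M0 s
      by (simp add: divide_right_mono power_mono)
    also have "\<dots> \<le> ?c * (?R ^ length w / fact (length w))"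
      by (intro mult_right_mono R) simp
    finally show "\<bar>signature e x u s w\<bar> \<le> ?c * (?R ^ length w / fact (length w))" .
    have "\<bar>append_vector (signature e x u s) (velocity e {u..u'} x s) w\<bar> \<le>
        1 / (u' - u) * (?R ^ length w / fact (length w))"
      using append_signature_bound[OF vel M s \<open>u < u'\<close>, of w] by (simp add: mult.commute)
    also have "\<dots> \<le> ?c * (?R ^ length w / fact (length w))"
      by (intro mult_right_mono R) simp
    finally show "\<bar>append_vector (signature e x u s) (velocity e {u..u'} x s) w\<bar> \<le>
        ?c * (?R ^ length w / fact (length w))" .
  qed
qed

section \<open>Inner products of tensors\<close>

lemma sum_words_Suc:
  "(\<Sum>w | length (w :: 'd::finite list) = Suc n. f w) = (\<Sum>w | length w = n. \<Sum>i\<in>UNIV. f (w @ [i]))"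
proof -
  have "(\<Sum>w | length w = n. \<Sum>i\<in>UNIV. f (w @ [i])) =
      (\<Sum>(w, i)\<in>{w. length w = n} \<times> UNIV. f (w @ [i]))"
    by (rule sum.cartesian_product)
  also have "\<dots> = (\<Sum>w | length w = Suc n. f w)"
    by (rule sum.reindex_bij_witness[where i = "\<lambda>w. (butlast w, last w)" and j = "\<lambda>(w, i). w @ [i]"])
       (auto simp: length_Suc_conv_rev)
  finally show ?thesis ..
qed

lemma tensor_inner_0: "tensor_inner e ip 0 A B = A [] * B []"
  by (simp add: tensor_inner_def)

text \<open>The inner product of tensors is multiplicative:
  \<open>\<langle>A \<otimes> a, B \<otimes> b\<rangle> = \<langle>A, B\<rangle> \<langle>a, b\<rangle>\<close> in each degree. This is what
  turns the differential equations of the two signatures into a partial differential equation that is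
  closed in the kernel.\<close>

lemma tensor_inner_append_vector_Suc:
  "tensor_inner e ip (Suc n) (append_vector A a) (append_vector B b) =
     (\<Sum>i\<in>UNIV. \<Sum>j\<in>UNIV. a i * b j * ip (e i) (e j)) * tensor_inner e ip n A B"
proof -
  have *: "(\<Prod>l<Suc n. ip (e ((w @ [i]) ! l)) (e ((w' @ [j]) ! l))) =
      (\<Prod>l<n. ip (e (w ! l)) (e (w' ! l))) * ip (e i) (e j)"
    if "length w = n" "length w' = n" for w w' i j
    using that by (auto simp: nth_append intro!: prod.cong)
  have "tensor_inner e ip (Suc n) (append_vector A a) (append_vector B b) =
      (\<Sum>w | length w = n. \<Sum>i\<in>UNIV. \<Sum>w' | length w' = n. \<Sum>j\<in>UNIV.
        A w * a i * (B w' * b j) * ((\<Prod>l<n. ip (e (w ! l)) (e (w' ! l))) * ip (e i) (e j)))"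
    unfolding tensor_inner_def sum_words_Suc by (intro sum.cong refl) (simp add: * del: prod.lessThan_Suc)
  also have "\<dots> = (\<Sum>w | length w = n. \<Sum>w' | length w' = n. \<Sum>i\<in>UNIV. \<Sum>j\<in>UNIV.
        A w * a i * (B w' * b j) * ((\<Prod>l<n. ip (e (w ! l)) (e (w' ! l))) * ip (e i) (e j)))"
    by (intro sum.cong refl sum.swap)
  also have "\<dots> = (\<Sum>i\<in>UNIV. \<Sum>j\<in>UNIV. a i * b j * ip (e i) (e j)) * tensor_inner e ip n A B"
    unfolding tensor_inner_def
    by (simp add: sum_distrib_left sum_distrib_right mult_ac)
  finally show ?thesis .
qed

lemma tensor_inner_commute:
  assumes "\<And>a b. ip a b = ip b a"
  shows "tensor_inner e ip n A B = tensor_inner e ip n B A"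
  unfolding tensor_inner_def
  by (subst sum.swap) (intro sum.cong refl arg_cong2[where f = "(*)"] mult.commute prod.cong assms)

text \<open>The crude estimate by the number of pairs of words is good enough: it is exponential in \<open>n\<close>, while
  the coefficients of signatures decay factorially.\<close>

lemma tensor_inner_bound:
  fixes e :: "'d::finite \<Rightarrow> 'a"
  assumes A: "\<And>w. length w = n \<Longrightarrow> \<bar>A w\<bar> \<le> \<alpha>"
    and B: "\<And>w. length w = n \<Longrightarrow> \<bar>B w\<bar> \<le> \<beta>"
    and C: "\<And>i j. \<bar>ip (e i) (e j)\<bar> \<le> C"
  shows "\<bar>tensor_inner e ip n A B\<bar> \<le> (real CARD('d) ^ n)\<^sup>2 * (\<alpha> * \<beta> * C ^ n)"
proof -
  have card: "card {w :: 'd list. length w = n} = CARD('d) ^ n"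
    using card_lists_length_eq[of "UNIV :: 'd set" n] by simp
  have le: "\<bar>A w * B w' * (\<Prod>l<n. ip (e (w ! l)) (e (w' ! l)))\<bar> \<le> \<alpha> * \<beta> * C ^ n"
    if w: "length w = n" "length w' = n" for w w'
  proof -
    have "0 \<le> \<alpha>" "0 \<le> \<beta>" using A[OF w(1)] B[OF w(2)] by linarith+
    moreover have "(\<Prod>l<n. \<bar>ip (e (w ! l)) (e (w' ! l))\<bar>) \<le> (\<Prod>l<n. C)"
      by (intro prod_mono conjI C) auto
    ultimately show ?thesis
      unfolding abs_mult abs_prod using A[OF w(1)] B[OF w(2)]
      by (intro mult_mono) (auto intro!: prod_nonneg)
  qed
  have "\<bar>tensor_inner e ip n A B\<bar> \<le> (\<Sum>w\<in>{w :: 'd list. length w = n}. \<Sum>w'\<in>{w :: 'd list. length w = n}. \<alpha> * \<beta> * C ^ n)"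
    unfolding tensor_inner_def by (intro order.trans[OF sum_abs] sum_mono le) auto
  also have "\<dots> = (real CARD('d) ^ n)\<^sup>2 * (\<alpha> * \<beta> * C ^ n)"
    by (simp add: card power2_eq_square)
  finally show ?thesis .
qed

text \<open>This is the right-hand side of \<open>tensor_inner_bound\<close> for coefficients with factorial decay.\<close>

lemma summable_tensor_bound:
  fixes c d :: real
  shows "summable (\<lambda>n. (d ^ n)\<^sup>2 * (c * (R ^ n / fact n) * (c' * (R' ^ n / fact n)) * C ^ n))"
proof -
  define z where "z = d\<^sup>2 * R * R' * C"
  have "summable (\<lambda>n. \<bar>c * c'\<bar> * (\<bar>z\<bar> ^ n /\<^sub>R fact n))"
    by (intro summable_mult summable_exp_generic)
  then show ?thesis
  proof (rule summable_comparison_test'[where N = 0])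
    fix n :: nat
    have "(d ^ n)\<^sup>2 * (c * (R ^ n / fact n) * (c' * (R' ^ n / fact n)) * C ^ n) =
        c * c' * (z ^ n / fact n) / fact n"
      by (simp add: z_def power_mult_distrib power2_eq_square)
    also have "norm \<dots> = \<bar>c * c'\<bar> * (\<bar>z\<bar> ^ n / fact n) / fact n"
      by (simp add: abs_mult power_abs)
    also have "\<dots> \<le> \<bar>c * c'\<bar> * (\<bar>z\<bar> ^ n / fact n) / 1"
      by (intro divide_left_mono) auto
    finally show "norm ((d ^ n)\<^sup>2 * (c * (R ^ n / fact n) * (c' * (R' ^ n / fact n)) * C ^ n)) \<le>
        \<bar>c * c'\<bar> * (\<bar>z\<bar> ^ n /\<^sub>R fact n)"
      by (simp add: field_simps)
  qed
qed

lemma tensor_inner_has_derivative_left: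
  assumes "\<And>w. ((\<lambda>s. A s w) has_real_derivative A' w) (at s within S)"
  shows "((\<lambda>s. tensor_inner e ip n (A s) B) has_real_derivative tensor_inner e ip n A' B) (at s within S)"
  unfolding tensor_inner_def by (intro DERIV_sum DERIV_cmult_right assms)

lemma tensor_inner_has_derivative_right:
  assumes "\<And>w. ((\<lambda>s. B s w) has_real_derivative B' w) (at s within S)"
  shows "((\<lambda>s. tensor_inner e ip n A (B s)) has_real_derivative tensor_inner e ip n A B') (at s within S)"
  unfolding tensor_inner_def by (intro DERIV_sum DERIV_cmult_right DERIV_cmult assms)

section \<open>Mixed derivatives of series\<close>

text \<open>Termwise differentiation, first in \<open>t\<close> and then in \<open>s\<close>; in either step the series of derivatives
  converges uniformly by the Weierstrass test.\<close>

lemma has_mixed_derivative_on_suminf: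
  assumes "convex S" "convex T"
    and f: "\<And>n s t. s \<in> S \<Longrightarrow> t \<in> T \<Longrightarrow> (f n s has_real_derivative g n s t) (at t within T)"
    and g: "\<And>n s t. s \<in> S \<Longrightarrow> t \<in> T \<Longrightarrow> ((\<lambda>s. g n s t) has_real_derivative D n s t) (at s within S)"
    and f_le: "\<And>n s t. s \<in> S \<Longrightarrow> t \<in> T \<Longrightarrow> \<bar>f n s t\<bar> \<le> c n"
    and g_le: "\<And>n s t. s \<in> S \<Longrightarrow> t \<in> T \<Longrightarrow> \<bar>g n s t\<bar> \<le> c n"
    and D_le: "\<And>n s t. s \<in> S \<Longrightarrow> t \<in> T \<Longrightarrow> \<bar>D n s t\<bar> \<le> c n"
    and c: "summable c"
  shows "has_mixed_derivative_on (\<lambda>s t. \<Sum>n. f n s t) (\<lambda>s t. \<Sum>n. D n s t) S T"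
proof -
  have deriv_suminf: "((\<lambda>x. \<Sum>n. h n x) has_real_derivative (\<Sum>n. h' n x)) (at x within X)"
    if X: "convex X" and x: "x \<in> X"
      and h: "\<And>n x. x \<in> X \<Longrightarrow> (h n has_real_derivative h' n x) (at x within X)"
      and le: "\<And>n x. x \<in> X \<Longrightarrow> \<bar>h n x\<bar> \<le> c n" "\<And>n x. x \<in> X \<Longrightarrow> \<bar>h' n x\<bar> \<le> c n"
    for h h' :: "nat \<Rightarrow> real \<Rightarrow> real" and x X
  proof -
    have "uniform_limit X (\<lambda>n x. \<Sum>i<n. h' i x) (\<lambda>x. \<Sum>n. h' n x) sequentially"
      by (rule Weierstrass_m_test[OF _ c]) (simp add: le)
    moreover have "summable (\<lambda>n. h n x)"
      by (rule summable_comparison_test'[OF c, of 0]) (simp add: le x)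
    ultimately obtain H where H: "\<forall>x\<in>X. (\<lambda>n. h n x) sums H x \<and> (H has_real_derivative (\<Sum>n. h' n x)) (at x within X)"
      using has_field_derivative_series[of X h h' _ x] X h x by blast
    then have "(H has_derivative (*) (\<Sum>n. h' n x)) (at x within X)"
      using x by (simp add: has_field_derivative_def)
    then show ?thesis
      unfolding has_field_derivative_def
      by (rule has_derivative_transform[OF x, rotated]) (use H in \<open>simp add: sums_iff\<close>)
  qed
  show ?thesis
    unfolding has_mixed_derivative_on_def
  proof (intro exI[of _ "\<lambda>s t. \<Sum>n. g n s t"] ballI conjI)
    fix s t assume st: "s \<in> S" "t \<in> T"
    show "((\<lambda>t. \<Sum>n. f n s t) has_real_derivative (\<Sum>n. g n s t)) (at t within T)"
      by (rule deriv_suminf[OF \<open>convex T\<close> st(2) f[OF st(1)] f_le[OF st(1)] g_le[OF st(1)]])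
    show "((\<lambda>s. \<Sum>n. g n s t) has_real_derivative (\<Sum>n. D n s t)) (at s within S)"
      by (rule deriv_suminf[OF \<open>convex S\<close> st(1) g[OF _ st(2)] g_le[OF _ st(2)] D_le[OF _ st(2)]])
  qed
qed

lemma has_mixed_derivative_on_cong:
  assumes "\<And>s t. s \<in> S \<Longrightarrow> t \<in> T \<Longrightarrow> D s t = D' s t"
    and "has_mixed_derivative_on f D S T"
  shows "has_mixed_derivative_on f D' S T"
proof -
  from assms(2) obtain g where g: "\<forall>s\<in>S. \<forall>t\<in>T.
      ((\<lambda>t'. f s t') has_real_derivative g s t) (at t within T) \<and>
      ((\<lambda>s'. g s' t) has_real_derivative D s t) (at s within S)"
    unfolding has_mixed_derivative_on_def by (elim exE)
  show ?thesis
    unfolding has_mixed_derivative_on_def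
  proof (intro exI[of _ g] ballI)
    fix s t assume st: "s \<in> S" "t \<in> T"
    show "((\<lambda>t'. f s t') has_real_derivative g s t) (at t within T) \<and>
      ((\<lambda>s'. g s' t) has_real_derivative D' s t) (at s within S)"
      unfolding assms(1)[OF st, symmetric] by (rule g[rule_format, OF st])
  qed
qed

section \<open>The signature kernel\<close>

lemma signature_kernel_commute:
  assumes "\<And>a b. ip a b = ip b a"
  shows "signature_kernel e ip x y u v s t = signature_kernel e ip y x v u t s"
  unfolding signature_kernel_def series_inner_def
  by (simp only: tensor_inner_commute[OF assms, where A = "signature e x u s"])

text \<open>Over a degenerate interval only the coefficient of the empty word survives.\<close>

lemma signature_kernel_left_end:
  assumes "\<And>i. continuous_on {u..u'} (\<lambda>r. velocity e {u..u'} x r i)" "u < u'"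
  shows "signature_kernel e ip x y u v u t = 1"
proof -
  have "signature e x u u w = 0" if "w \<noteq> []" for w
    using that signature_snoc[OF assms(1), where s = u] \<open>u < u'\<close>
    by (cases w rule: rev_cases) auto
  then have "tensor_inner e ip n (signature e x u u) B = 0" if "n > 0" for n B
    unfolding tensor_inner_def using that by (intro sum.neutral ballI) auto
  then have "signature_kernel e ip x y u v u t =
      (\<Sum>n\<in>{0}. tensor_inner e ip n (signature e x u u) (signature e y v t))"
    unfolding signature_kernel_def series_inner_def by (intro suminf_finite) auto
  then show ?thesis by (simp add: tensor_inner_0)
qed

text \<open>Since \<open>dS = S \<otimes> dx\<close> for both paths, the mixed derivative of the degree \<open>n\<close> term is the inner
  product of \<open>S(x) \<otimes> dx\<close> and \<open>S(y) \<otimes> dy\<close> in degree \<open>n\<close>. It vanishes for \<open>n = 0\<close>, and for larger \<open>n\<close> it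
  is \<open>\<langle>dx, dy\<rangle>\<close> times the term of degree \<open>n - 1\<close>; summation reproduces the kernel.\<close>

lemma
  fixes e :: "'d::finite \<Rightarrow> 'a::real_normed_vector"
  assumes e: "is_basis e" and ip: "is_inner_product ip" and "u < u'" "v < v'"
    and x: "C1_path {u..u'} x" and y: "C1_path {v..v'} y"
  shows summable_signature_kernel: "\<And>s t. s \<in> {u..u'} \<Longrightarrow> t \<in> {v..v'} \<Longrightarrow>
            summable (\<lambda>n. tensor_inner e ip n (signature e x u s) (signature e y v t))"
    and signature_kernel_has_mixed_derivative:
          "has_mixed_derivative_on (signature_kernel e ip x y u v)
             (\<lambda>s t. ip (vector_derivative x (at s within {u..u'})) (vector_derivative y (at t within {v..v'})) *
                    signature_kernel e ip x y u v s t) {u..u'} {v..v'}"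
proof -
  note vx = continuous_on_velocity[OF e x] and vy = continuous_on_velocity[OF e y]
  let ?X = "signature e x u" and ?Y = "signature e y v"
  let ?X' = "\<lambda>s. append_vector (?X s) (velocity e {u..u'} x s)"
  let ?Y' = "\<lambda>t. append_vector (?Y t) (velocity e {v..v'} y t)"
  let ?P = "\<lambda>s t. ip (vector_derivative x (at s within {u..u'})) (vector_derivative y (at t within {v..v'}))"
  obtain c R where X: "\<And>s w. s \<in> {u..u'} \<Longrightarrow> \<bar>?X s w\<bar> \<le> c * (R ^ length w / fact (length w))"
      "\<And>s w. s \<in> {u..u'} \<Longrightarrow> \<bar>?X' s w\<bar> \<le> c * (R ^ length w / fact (length w))"
    using signature_exponential_bound[OF vx \<open>u < u'\<close>] by blast
  obtain c' R' where Y: "\<And>t w. t \<in> {v..v'} \<Longrightarrow> \<bar>?Y t w\<bar> \<le> c' * (R' ^ length w / fact (length w))"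
      "\<And>t w. t \<in> {v..v'} \<Longrightarrow> \<bar>?Y' t w\<bar> \<le> c' * (R' ^ length w / fact (length w))"
    using signature_exponential_bound[OF vy \<open>v < v'\<close>] by blast
  have "bounded (range (\<lambda>(i, j). ip (e i) (e j)))"
    by (intro finite_imp_bounded) simp
  then obtain C where C: "\<And>i j. \<bar>ip (e i) (e j)\<bar> \<le> C"
    by (auto simp: bounded_iff)
  define q where "q \<equiv> (\<lambda>n. (real CARD('d) ^ n)\<^sup>2 *
    (c * (R ^ n / fact n) * (c' * (R' ^ n / fact n)) * C ^ n))"
  have q: "summable q"
    unfolding q_def by (rule summable_tensor_bound)
  have q_bound: "\<bar>tensor_inner e ip n A B\<bar> \<le> q n"
    if "\<And>w. \<bar>A w\<bar> \<le> c * (R ^ length w / fact (length w))"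
      "\<And>w. \<bar>B w\<bar> \<le> c' * (R' ^ length w / fact (length w))" for A B n
    unfolding q_def
  proof (rule tensor_inner_bound)
    show "\<bar>A w\<bar> \<le> c * (R ^ n / fact n)" if "length w = n" for w
      using \<open>\<And>w. \<bar>A w\<bar> \<le> _\<close>[of w] unfolding that .
    show "\<bar>B w\<bar> \<le> c' * (R' ^ n / fact n)" if "length w = n" for w
      using \<open>\<And>w. \<bar>B w\<bar> \<le> _\<close>[of w] unfolding that .
  qed (rule C)
  have summ: "summable (\<lambda>n. tensor_inner e ip n (?X s) (?Y t))" if "s \<in> {u..u'}" "t \<in> {v..v'}" for s t
    by (rule summable_comparison_test'[OF q, of 0], unfold real_norm_def) (intro q_bound X Y that)
  then show "\<And>s t. s \<in> {u..u'} \<Longrightarrow> t \<in> {v..v'} \<Longrightarrow> summable (\<lambda>n. tensor_inner e ip n (?X s) (?Y t))" .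
  have sum_D: "(\<Sum>n. tensor_inner e ip n (?X' s) (?Y' t)) = ?P s t * signature_kernel e ip x y u v s t"
    if st: "s \<in> {u..u'}" "t \<in> {v..v'}" for s t
  proof -
    have "(\<lambda>n. tensor_inner e ip (Suc n) (?X' s) (?Y' t)) sums (?P s t * signature_kernel e ip x y u v s t)"
      unfolding tensor_inner_append_vector_Suc inner_velocity[OF e ip] signature_kernel_def series_inner_def
      by (intro sums_mult summable_sums summ st)
    \<comment> \<open>The mixed derivative of the constant term of degree 0 is zero.\<close>
    from sums_Suc[OF this] show ?thesis
      by (intro sums_unique[symmetric]) (simp add: tensor_inner_0)
  qed
  have "has_mixed_derivative_on (\<lambda>s t. \<Sum>n. tensor_inner e ip n (?X s) (?Y t))
      (\<lambda>s t. \<Sum>n. tensor_inner e ip n (?X' s) (?Y' t)) {u..u'} {v..v'}"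
  proof (rule has_mixed_derivative_on_suminf[where g = "\<lambda>n s t. tensor_inner e ip n (?X s) (?Y' t)", OF _ _ _ _ _ _ _ q])
    fix n s t assume st: "s \<in> {u..u'}" "t \<in> {v..v'}"
    show "((\<lambda>t. tensor_inner e ip n (?X s) (?Y t)) has_real_derivative tensor_inner e ip n (?X s) (?Y' t))
        (at t within {v..v'})"
      by (intro tensor_inner_has_derivative_right signature_has_derivative vy st)
    show "((\<lambda>s. tensor_inner e ip n (?X s) (?Y' t)) has_real_derivative tensor_inner e ip n (?X' s) (?Y' t))
        (at s within {u..u'})"
      by (intro tensor_inner_has_derivative_left signature_has_derivative vx st)
    show "\<bar>tensor_inner e ip n (?X s) (?Y t)\<bar> \<le> q n" "\<bar>tensor_inner e ip n (?X s) (?Y' t)\<bar> \<le> q n"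
        "\<bar>tensor_inner e ip n (?X' s) (?Y' t)\<bar> \<le> q n"
      by (intro q_bound X Y st)+
  qed simp_all
  then have "has_mixed_derivative_on (signature_kernel e ip x y u v)
      (\<lambda>s t. \<Sum>n. tensor_inner e ip n (?X' s) (?Y' t)) {u..u'} {v..v'}"
    unfolding signature_kernel_def[abs_def] series_inner_def .
  then show "has_mixed_derivative_on (signature_kernel e ip x y u v)
      (\<lambda>s t. ?P s t * signature_kernel e ip x y u v s t) {u..u'} {v..v'}"
    by (rule has_mixed_derivative_on_cong[rotated]) (rule sum_D)
qed

theorem theorem2p5:
  fixes e :: "'d::finite \<Rightarrow> 'a::banach"
    and ip :: "'a \<Rightarrow> 'a \<Rightarrow> real"
    and x y :: "real \<Rightarrow> 'a"
    and u u' v v' :: real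
  defines "k \<equiv> signature_kernel e ip x y u v"
    and "D \<equiv> (\<lambda>s t. ip (vector_derivative x (at s within {u..u'}))
                       (vector_derivative y (at t within {v..v'})) *
                    signature_kernel e ip x y u v s t)"
  assumes "is_basis e" and "is_inner_product ip"
    and "u < u'" and "v < v'"
    and "C1_path {u..u'} x" and "C1_path {v..v'} y"
  shows "(\<forall>s\<in>{u..u'}. \<forall>t\<in>{v..v'}.
            summable (\<lambda>n. tensor_inner e ip n (signature e x u s) (signature e y v t))) \<and>
         has_mixed_derivative_on k D {u..u'} {v..v'} \<and>
         has_mixed_derivative_on (\<lambda>t s. k s t) (\<lambda>t s. D s t) {v..v'} {u..u'} \<and>
         (\<forall>t\<in>{v..v'}. k u t = 1) \<and>
         (\<forall>s\<in>{u..u'}. k s v = 1)"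
proof (intro conjI ballI)
  have sym: "ip a b = ip b a" for a b
    using \<open>is_inner_product ip\<close> by (simp add: is_inner_product_def)
  have k_swap: "k s t = signature_kernel e ip y x v u t s" for s t
    unfolding k_def by (rule signature_kernel_commute[OF sym])
  show "summable (\<lambda>n. tensor_inner e ip n (signature e x u s) (signature e y v t))"
    if "s \<in> {u..u'}" "t \<in> {v..v'}" for s t
    by (rule summable_signature_kernel[OF assms(3-8) that])
  show "has_mixed_derivative_on k D {u..u'} {v..v'}"
    unfolding k_def D_def by (rule signature_kernel_has_mixed_derivative[OF assms(3-8)])
  have D_swap: "D s t = ip (vector_derivative y (at t within {v..v'})) (vector_derivative x (at s within {u..u'})) *
      signature_kernel e ip y x v u t s" for s t
    unfolding D_def k_swap[unfolded k_def]
    by (subst sym) (rule refl)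
  \<comment> \<open>Exchanging the two paths exchanges the order of differentiation.\<close>
  show "has_mixed_derivative_on (\<lambda>t s. k s t) (\<lambda>t s. D s t) {v..v'} {u..u'}"
    unfolding k_swap D_swap
    by (rule signature_kernel_has_mixed_derivative[OF assms(3,4,6,5,8,7)])
  show "k u t = 1" for t
    unfolding k_def by (rule signature_kernel_left_end[OF continuous_on_velocity[OF assms(3,7)] assms(5)])
  show "k s v = 1" for s
    unfolding k_swap by (rule signature_kernel_left_end[OF continuous_on_velocity[OF assms(3,8)] assms(6)])
qed

end
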